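(* Let $\Omega$ and $\widetilde\Omega$ be the open unit balls of norms $\|\cdot\|_\Omega$ and $\|\cdot\|_{\widetilde\Omega}$ on $\mathbb C^m$, and suppose $\varphi:\widetilde\Omega\to\Omega$ is a bi-holomorphic map with $\varphi(0)=0$. Then every contractive linear map from $(\mathbb C^m,\|\cdot\|_\Omega)$ to $\mathcal M_n(\mathbb C)$ (for all $n$) is completely contractive if and only if every contractive linear map from $(\mathbb C^m,\|\cdot\|_{\widetilde\Omega})$ to $\mathcal M_n(\mathbb C)$ (for all $n$) is completely contractive.
   Context: $\mathcal M_n(\mathbb C)$ carries the operator norm $\|\cdot\|_{\rm op}$. For a norm $\|\cdot\|$ on $\mathbb C^m$ and $k\ge1$, an element $\Theta=(\Theta_1,\dots,\Theta_m)\in\mathbb C^m\otimes\mathcal M_k(\mathbb C)$ is given the norm $\|\Theta\|_k=\sup\{\|\sum_i\lambda_i\Theta_i\|_{\rm op}:\ \|\lambda\|^*\le1\}$, where $\|\cdot\|^*$ is the dual norm with respect to the pairing $\sum_i\lambda_iz_i$. A linear map $L:(\mathbb C^m,\|\cdot\|)\to\mathcal M_n(\mathbb C)$, $L(z)=\sum_iz_iV_i$, is contractive if $\|L(z)\|_{\rm op}\le\|z\|$ for all $z$, and completely contractive if $\|\sum_i\Theta_i\otimes V_i\|_{\rm op}\le\|\Theta\|_k$ for all $k\ge1$ and all $\Theta\in\mathbb C^m\otimes\mathcal M_k(\mathbb C)$. *)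

theory Defs
  imports "HOL-Analysis.Analysis" "Jordan_Normal_Form.Matrix"
begin

text \<open>
  The space \<open>\<complex>\<^sup>m\<close> is \<open>complex ^ 'm\<close> from HOL-Analysis. Matrices are the \<open>complex mat\<close> of
  Jordan_Normal_Form, because their size has to be quantified inside formulas.
  Both libraries write \<open>$\<close> for component access; only the HOL-Analysis meaning is kept.
\<close>

no_notation vec_index (infixl "$" 100)

definition is_norm :: "(complex ^ 'm \<Rightarrow> real) \<Rightarrow> bool" where
  "is_norm N \<longleftrightarrow>
     (\<forall>z. 0 \<le> N z) \<and>
     (\<forall>z. N z = 0 \<longleftrightarrow> z = 0) \<and>
     (\<forall>c z. N (c *s z) = cmod c * N z) \<and>
     (\<forall>z w. N (z + w) \<le> N z + N w)"

definition open_unit_ball :: "(complex ^ 'm \<Rightarrow> real) \<Rightarrow> (complex ^ 'm) set" where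
  "open_unit_ball N = {z. N z < 1}"

definition dual_norm :: "(complex ^ 'm \<Rightarrow> real) \<Rightarrow> complex ^ 'm \<Rightarrow> real" where
  "dual_norm N l = Sup {cmod (\<Sum>i\<in>UNIV. l $ i * z $ i) | z. N z \<le> 1}"

text \<open>Holomorphy in several variables, meant for open \<open>S\<close>: at every point of \<open>S\<close> there is a
  complex-linear Frechet derivative. (A real-linear one is part of \<open>has_derivative\<close>.)\<close>

definition holomorphic_map_on ::
  "(complex ^ 'm \<Rightarrow> complex ^ 'k) \<Rightarrow> (complex ^ 'm) set \<Rightarrow> bool" where
  "holomorphic_map_on f S \<longleftrightarrow>
     (\<forall>z\<in>S. \<exists>D. (f has_derivative D) (at z) \<and> (\<forall>c v. D (c *s v) = c *s D v))"

definition biholomorphic ::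
  "(complex ^ 'm \<Rightarrow> complex ^ 'k) \<Rightarrow> (complex ^ 'm) set \<Rightarrow> (complex ^ 'k) set \<Rightarrow> bool" where
  "biholomorphic f S T \<longleftrightarrow>
     bij_betw f S T \<and> holomorphic_map_on f S \<and> holomorphic_map_on (inv_into S f) T"

definition euclid_norm :: "complex Matrix.vec \<Rightarrow> real" where
  "euclid_norm v = L2_set (\<lambda>i. cmod (vec_index v i)) {..<dim_vec v}"

definition op_norm :: "complex mat \<Rightarrow> real" where
  "op_norm A = Sup {euclid_norm (A *\<^sub>v v) | v. v \<in> carrier_vec (dim_col A) \<and> euclid_norm v \<le> 1}"

text \<open>The sum of a finite family of \<open>k \<times> k\<close> matrices. The type \<open>'a mat\<close> has no zero common to
  all sizes, so \<open>sum\<close> is not available on it.\<close>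

definition matrix_sum :: "nat \<Rightarrow> ('m::finite \<Rightarrow> complex mat) \<Rightarrow> complex mat" where
  "matrix_sum k A = Matrix.mat k k (\<lambda>(r, s). \<Sum>i\<in>UNIV. A i $$ (r, s))"

text \<open>The tensor product of matrices as the Kronecker product: the basis vector
  \<open>e\<^sub>a \<otimes> e\<^sub>b\<close> has index \<open>a * n + b\<close>, where \<open>n\<close> is the size of the second factor.\<close>

definition kronecker :: "complex mat \<Rightarrow> complex mat \<Rightarrow> complex mat" where
  "kronecker A B = Matrix.mat (dim_row A * dim_row B) (dim_col A * dim_col B)
     (\<lambda>(r, s). A $$ (r div dim_row B, s div dim_col B) * B $$ (r mod dim_row B, s mod dim_col B))"

text \<open>An element of \<open>\<complex>\<^sup>m \<otimes> M\<^sub>k(\<complex>)\<close> is a family \<open>\<Theta>\<close> of \<open>k \<times> k\<close> matrices.\<close>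

definition tensor_norm ::
  "(complex ^ 'm::finite \<Rightarrow> real) \<Rightarrow> nat \<Rightarrow> ('m \<Rightarrow> complex mat) \<Rightarrow> real" where
  "tensor_norm N k \<Theta> = Sup {op_norm (matrix_sum k (\<lambda>i. (l $ i) \<cdot>\<^sub>m \<Theta> i)) | l. dual_norm N l \<le> 1}"

definition matrix_linear :: "nat \<Rightarrow> (complex ^ 'm \<Rightarrow> complex mat) \<Rightarrow> bool" where
  "matrix_linear n L \<longleftrightarrow>
     (\<forall>z. L z \<in> carrier_mat n n) \<and>
     (\<forall>z w. L (z + w) = L z + L w) \<and>
     (\<forall>c z. L (c *s z) = c \<cdot>\<^sub>m L z)"

definition contractive ::
  "(complex ^ 'm \<Rightarrow> real) \<Rightarrow> (complex ^ 'm \<Rightarrow> complex mat) \<Rightarrow> bool" where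
  "contractive N L \<longleftrightarrow> (\<forall>z. op_norm (L z) \<le> N z)"

text \<open>The coefficient matrices \<open>V\<^sub>i\<close> of \<open>L(z) = \<Sum>\<^sub>i z\<^sub>i V\<^sub>i\<close> are the values of \<open>L\<close> on the
  standard basis.\<close>

definition completely_contractive ::
  "(complex ^ 'm::finite \<Rightarrow> real) \<Rightarrow> nat \<Rightarrow> (complex ^ 'm \<Rightarrow> complex mat) \<Rightarrow> bool" where
  "completely_contractive N n L \<longleftrightarrow>
     (\<forall>k\<ge>1. \<forall>\<Theta>. (\<forall>i. \<Theta> i \<in> carrier_mat k k) \<longrightarrow>
        op_norm (matrix_sum (k * n) (\<lambda>i. kronecker (\<Theta> i) (L (axis i 1)))) \<le> tensor_norm N k \<Theta>)"

end

theory Submission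
  imports Defs "HOL-Complex_Analysis.Complex_Analysis"
begin

text \<open>
  By the Schwarz lemma, composed with linear functionals that separate points from the closed
  unit ball, the derivative of a holomorphic map between unit balls fixing the origin does not
  increase norms. For a biholomorphic map this applies to the inverse as well, so the derivative
  at the origin is a linear isometry \<open>A\<close> of the two normed spaces. Contractive maps are carried
  over by composition with \<open>A\<close>, elements of \<open>\<complex>\<^sup>m \<otimes> M\<^sub>k(\<complex>)\<close> by \<open>A\<^sup>-\<^sup>1 \<otimes> id\<close>, and both norms entering
  complete contractivity are invariant under this transport.
\<close>

section \<open>Norms on complex coordinate space: convexity, continuity, unit balls\<close>

lemma is_normD:
  assumes "is_norm N"
  shows "0 \<le> N z" "N z = 0 \<longleftrightarrow> z = 0" "N (c *s z) = cmod c * N z" "N (z + w) \<le> N z + N w"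
  using assms unfolding is_norm_def by blast+

lemma scaleR_vec_eq: "r *\<^sub>R z = complex_of_real r *s (z :: complex ^ 'm)"
  by (simp add: Finite_Cartesian_Product.vec_eq_iff scaleR_conv_of_real[where 'a=complex])

lemma is_norm_convex_on:
  fixes N :: "complex ^ 'm::finite \<Rightarrow> real"
  assumes "is_norm N"
  shows "convex_on UNIV N"
proof (rule convex_onI)
  fix t :: real and x y :: "complex ^ 'm"
  assume "0 < t" "t < 1"
  have "N ((1 - t) *\<^sub>R x + t *\<^sub>R y) \<le> N ((1 - t) *\<^sub>R x) + N (t *\<^sub>R y)"
    by (rule is_normD(4)[OF assms])
  also have "\<dots> = (1 - t) * N x + t * N y"
    using \<open>0 < t\<close> \<open>t < 1\<close>
    by (simp only: scaleR_vec_eq is_normD(3)[OF assms] norm_of_real)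
  finally show "N ((1 - t) *\<^sub>R x + t *\<^sub>R y) \<le> (1 - t) * N x + t * N y" .
qed simp

text \<open>A convex function on an open subset of a finite-dimensional space is continuous, so
  \<open>N\<close> need not be compared with the Euclidean norm.\<close>

lemma is_norm_continuous_on:
  fixes N :: "complex ^ 'm::finite \<Rightarrow> real"
  assumes "is_norm N"
  shows "continuous_on S N"
  using convex_on_continuous[OF open_UNIV is_norm_convex_on[OF assms]]
  by (rule continuous_on_subset) simp

lemma open_open_unit_ball:
  fixes N :: "complex ^ 'm::finite \<Rightarrow> real"
  assumes "is_norm N"
  shows "open (open_unit_ball N)"
  unfolding open_unit_ball_def
  by (intro open_Collect_less is_norm_continuous_on[OF assms] continuous_on_const)

lemma closed_norm_ball:
  fixes N :: "complex ^ 'm::finite \<Rightarrow> real"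
  assumes "is_norm N"
  shows "closed {z. N z \<le> 1}"
  by (intro closed_Collect_le is_norm_continuous_on[OF assms] continuous_on_const)

lemma convex_norm_ball:
  fixes N :: "complex ^ 'm::finite \<Rightarrow> real"
  assumes "is_norm N"
  shows "convex {z. N z \<le> 1}"
proof (rule convexI, clarify)
  fix x y and u v :: real
  assume *: "N x \<le> 1" "N y \<le> 1" "0 \<le> u" "0 \<le> v" "u + v = 1"
  then have "N (u *\<^sub>R x + v *\<^sub>R y) \<le> u * N x + v * N y"
    using is_norm_convex_on[OF assms] unfolding convex_on_def by blast
  also have "\<dots> \<le> 1" using * by (intro convex_bound_le)
  finally show "N (u *\<^sub>R x + v *\<^sub>R y) \<le> 1" .
qed

lemma zero_in_open_unit_ball: "is_norm N \<Longrightarrow> 0 \<in> open_unit_ball N"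
  using is_normD(2)[of N 0] by (simp add: open_unit_ball_def)

section \<open>Separation by complex-linear functionals\<close>

definition linear_form :: "complex ^ 'm::finite \<Rightarrow> complex ^ 'm \<Rightarrow> complex" where
  "linear_form l z = (\<Sum>i\<in>UNIV. l $ i * z $ i)"

lemma linear_form_smult: "linear_form l (c *s z) = c * linear_form l z"
  by (simp add: linear_form_def sum_distrib_left algebra_simps)

lemma bounded_linear_linear_form: "bounded_linear (linear_form l)"
  unfolding linear_form_def
  by (intro bounded_linear_sum bounded_linear_const_mult bounded_linear_vec_nth)

text \<open>The pairing in \<open>linear_form\<close> is bilinear. Conjugating the coefficients
  exhibits a real functional as the real part of a complex-linear one.\<close>

lemma Re_linear_form_cnj: "Re (linear_form (\<chi> i. cnj (a $ i)) z) = a \<bullet> z"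
  by (simp add: linear_form_def inner_vec_def inner_complex_def)

text \<open>A real separating hyperplane is complexified. Since the ball is invariant under
  unimodular scalars, the bound on real parts becomes a bound on moduli. It is strict on the closed
  ball, as the Schwarz lemma will require.\<close>

lemma exists_separating_linear_form:
  fixes N :: "complex ^ 'm::finite \<Rightarrow> real"
  assumes N: "is_norm N" and w: "N w > 1"
  obtains l where "\<And>z. N z \<le> 1 \<Longrightarrow> cmod (linear_form l z) < 1" "cmod (linear_form l w) > 1"
proof -
  obtain a b where ab: "a \<bullet> w < b" "\<forall>z\<in>{z. N z \<le> 1}. a \<bullet> z > b"
    using separating_hyperplane_closed_point[OF convex_norm_ball[OF N] closed_norm_ball[OF N], of w] w
    by auto
  \<comment> \<open>The origin lies in the ball, so the hyperplane level is negative, and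
    \<open>- b\<close> can serve as a threshold for moduli.\<close>
  have b: "b < 0" using ab(2)[rule_format, of 0] is_normD(2)[OF N, of 0] by simp
  define l where "l = (\<chi> i. cnj (a $ i))"
  have Re: "Re (linear_form l z) = a \<bullet> z" for z
    unfolding l_def by (rule Re_linear_form_cnj)
  have *: "cmod (linear_form l z) < - b" if z: "N z \<le> 1" for z
  proof (cases "linear_form l z = 0")
    case False
    let ?x = "linear_form l z"
    \<comment> \<open>Rotate \<open>z\<close> so that the form takes the value \<open>-\<bar>l z\<bar>\<close>.\<close>
    define c where "c = - cnj ?x / complex_of_real (cmod ?x)"
    have "cmod c = 1" using False by (simp add: c_def norm_divide)
    then have "N (c *s z) \<le> 1" using z by (simp add: is_normD(3)[OF N])
    then have "b < Re (linear_form l (c *s z))" using ab(2) Re by simp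
    also have "linear_form l (c *s z) = - complex_of_real (cmod ?x)"
      using False complex_norm_square[of ?x] unfolding linear_form_smult c_def
      by (simp add: field_simps power2_eq_square)
    finally show ?thesis by simp
  qed (use b in simp)
  \<comment> \<open>Dividing the form by \<open>- b\<close> moves the threshold to 1.\<close>
  let ?d = "complex_of_real (1 / (- b))"
  have sc: "linear_form (?d *s l) z = ?d * linear_form l z" for z
    by (simp add: linear_form_def sum_distrib_left algebra_simps)
  show ?thesis
  proof
    fix z assume "N z \<le> 1"
    then show "cmod (linear_form (?d *s l) z) < 1"
      using * b unfolding sc norm_mult norm_of_real by (simp add: field_simps)
  next
    have "cmod (linear_form l w) > - b"
      using ab(1) abs_Re_le_cmod[of "linear_form l w"] Re[of w] by linarith
    then show "cmod (linear_form (?d *s l) w) > 1"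
      using b unfolding sc norm_mult norm_of_real by (simp add: field_simps)
  qed
qed

section \<open>The Schwarz lemma for maps between unit balls\<close>

lemma derivative_norm_le:
  fixes M N :: "complex ^ 'm::finite \<Rightarrow> real"
  assumes M: "is_norm M" and N: "is_norm N"
    and f: "holomorphic_map_on f (open_unit_ball M)" "f ` open_unit_ball M \<subseteq> open_unit_ball N" "f 0 = 0"
    and D: "(f has_derivative D) (at 0)" "\<And>c v. D (c *s v) = c *s D v"
  shows "N (D v) \<le> M v"
proof -
  have unit: "N (D u) \<le> 1" if u: "M u < 1" for u
  proof (rule ccontr)
    assume "\<not> N (D u) \<le> 1"
    then obtain l where l: "\<And>z. N z \<le> 1 \<Longrightarrow> cmod (linear_form l z) < 1"
        "cmod (linear_form l (D u)) > 1"
      using exists_separating_linear_form[OF N, of "D u"] by auto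
    \<comment> \<open>Restricted to the complex line through \<open>u\<close> and followed by
      \<open>l\<close>, \<open>f\<close> becomes a holomorphic self-map of the unit disc that fixes
      0 and has derivative \<open>linear_form l (D u)\<close> there.\<close>
    define h where "h \<zeta> = linear_form l (f (\<zeta> *s u))" for \<zeta>
    have in_ball: "\<zeta> *s u \<in> open_unit_ball M" if "cmod \<zeta> < 1" for \<zeta>
    proof -
      have "cmod \<zeta> * M u \<le> 1 * M u" using that is_normD(1)[OF M] by (intro mult_right_mono) auto
      then show ?thesis using u by (simp add: open_unit_ball_def is_normD(3)[OF M])
    qed
    have line: "((\<lambda>\<zeta>. \<zeta> *s u) has_derivative (\<lambda>\<zeta>. \<zeta> *s u)) (at \<xi>)" for \<xi>
    proof -
      have "bounded_linear (\<lambda>\<zeta>. \<zeta> *s u)"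
        by (rule linear_conv_bounded_linear[THEN iffD1])
          (auto intro!: linearI simp: Finite_Cartesian_Product.vec_eq_iff algebra_simps)
      then show ?thesis by (rule bounded_linear_imp_has_derivative)
    qed
    \<comment> \<open>Complex homogeneity of \<open>E\<close> turns the real derivative from the
      chain rule into multiplication by a complex number.\<close>
    have deriv: "(h has_field_derivative linear_form l (E u)) (at \<xi>)"
      if "(f has_derivative E) (at (\<xi> *s u))" "\<And>c v. E (c *s v) = c *s E v" for E \<xi>
    proof -
      have "(h has_derivative (\<lambda>\<zeta>. linear_form l (E (\<zeta> *s u)))) (at \<xi>)"
        unfolding h_def
        by (intro bounded_linear.has_derivative[OF bounded_linear_linear_form]
              has_derivative_compose[OF line that(1)])
      then show ?thesis
        by (simp add: has_field_derivative_def that(2) linear_form_smult mult.commute[of _ "linear_form l (E u)"])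
    qed
    have "h holomorphic_on ball 0 1"
    proof (rule holomorphic_onI)
      fix \<xi> :: complex assume "\<xi> \<in> ball 0 1"
      then obtain E where "(f has_derivative E) (at (\<xi> *s u))" "\<And>c v. E (c *s v) = c *s E v"
        using f(1) in_ball[of \<xi>] unfolding holomorphic_map_on_def by auto
      then have "(h has_field_derivative linear_form l (E u)) (at \<xi>)" by (rule deriv)
      then show "h field_differentiable at \<xi> within ball 0 1"
        using field_differentiable_at_within field_differentiable_def by blast
    qed
    moreover have "h 0 = 0"
      by (simp add: h_def f(3) linear_form_def)
    moreover have "cmod (h \<zeta>) < 1" if "cmod \<zeta> < 1" for \<zeta>
      using in_ball[OF that] f(2) l(1)[of "f (\<zeta> *s u)"] by (force simp: h_def open_unit_ball_def)
    ultimately have "cmod (deriv h 0) \<le> 1"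
      by (rule Schwarz_Lemma(2)[of h 0]) simp_all
    moreover have "deriv h 0 = linear_form l (D u)"
      by (intro DERIV_imp_deriv deriv) (use D in simp_all)
    ultimately show False using l(2) by simp
  qed
  show ?thesis
  proof (rule field_le_epsilon)
    fix e :: real assume "0 < e"
    \<comment> \<open>The summand \<open>e\<close> puts \<open>v\<close> divided by \<open>t\<close>
      strictly inside the ball and keeps \<open>t\<close> positive even for
      \<open>v = 0\<close>.\<close>
    define t where "t = M v + e"
    have t: "0 < t" "M v < t" using is_normD(1)[OF M, of v] \<open>0 < e\<close> by (auto simp: t_def)
    have "N (D (complex_of_real (1 / t) *s v)) \<le> 1"
      by (rule unit) (use t in \<open>simp add: is_normD(3)[OF M] norm_divide\<close>)
    then show "N (D v) \<le> M v + e"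
      using t unfolding D(2) is_normD(3)[OF N] norm_of_real t_def[symmetric] by (simp add: field_simps)
  qed
qed

section \<open>The derivative at the origin as an invertible isometry\<close>

lemma has_derivative_local_inverse:
  assumes "(f has_derivative D) (at a)" "(g has_derivative E) (at (f a))"
    and "open S" "a \<in> S" "\<And>z. z \<in> S \<Longrightarrow> g (f z) = z"
  shows "E (D v) = v"
proof -
  have "((\<lambda>z. g (f z)) has_derivative (\<lambda>v. E (D v))) (at a)"
    by (rule has_derivative_compose[OF assms(1,2)])
  \<comment> \<open>The composite is known to be the identity only on \<open>S\<close>; as
    \<open>S\<close> is open, this determines its derivative at \<open>a\<close>.\<close>
  then have "((\<lambda>z. z) has_derivative (\<lambda>v. E (D v))) (at a)"
    by (rule has_derivative_transform_within_open) (use assms in auto)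
  from has_derivative_unique[OF this has_derivative_ident] show ?thesis
    by (rule fun_cong)
qed

text \<open>\<open>has_derivative\<close> supplies additivity; with complex homogeneity this is
  linearity over the complex numbers, so \<open>D\<close> acts as its Jacobian matrix.\<close>

lemma derivative_complex_linear:
  fixes D :: "complex ^ 'm::finite \<Rightarrow> complex ^ 'k::finite"
  assumes "(f has_derivative D) F" "\<And>c v. D (c *s v) = c *s D v"
  shows "matrix D *v v = D v"
proof (rule matrix_works)
  show "Vector_Spaces.linear (*s) (*s) D"
    using assms(2) has_derivative_linear[OF assms(1)]
    by (intro Vector_Spaces.linear.intro)
       (auto simp: module_hom_axioms_def vec.vector_space_axioms linear_add module_hom_def
          vec.module_axioms intro!: module_hom.intro)
qed

text \<open>The isometry is given by matrices, since its transpose will act on functionals and its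
  entries on tensors.\<close>

lemma biholomorphic_imp_linear_isometry:
  fixes M N :: "complex ^ 'm::finite \<Rightarrow> real"
  assumes M: "is_norm M" and N: "is_norm N"
    and bihol: "biholomorphic f (open_unit_ball M) (open_unit_ball N)" and f0: "f 0 = 0"
  obtains A B :: "complex ^ 'm ^ 'm"
  where "A ** B = Finite_Cartesian_Product.mat 1" "B ** A = Finite_Cartesian_Product.mat 1" "\<And>z. N (A *v z) = M z"
proof -
  let ?S = "open_unit_ball M" and ?T = "open_unit_ball N"
  define g where "g = inv_into ?S f"
  have bij: "bij_betw f ?S ?T" and hf: "holomorphic_map_on f ?S" and hg: "holomorphic_map_on g ?T"
    using bihol by (auto simp: biholomorphic_def g_def)
  have gf: "g (f z) = z" if "z \<in> ?S" for z
    using that bij unfolding g_def bij_betw_def by simp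
  have fg: "f (g z) = z" if "z \<in> ?T" for z
    using that bij_betw_inv_into_right[OF bij] unfolding g_def by simp
  have im: "f ` ?S \<subseteq> ?T" "g ` ?T \<subseteq> ?S"
    using bij bij_betw_inv_into[OF bij] unfolding g_def bij_betw_def by auto
  have g0: "g 0 = 0" using gf[OF zero_in_open_unit_ball[OF M]] f0 by simp
  obtain D where D: "(f has_derivative D) (at 0)" "\<And>c v. D (c *s v) = c *s D v"
    using hf zero_in_open_unit_ball[OF M] unfolding holomorphic_map_on_def by metis
  obtain E where E: "(g has_derivative E) (at 0)" "\<And>c v. E (c *s v) = c *s E v"
    using hg zero_in_open_unit_ball[OF N] unfolding holomorphic_map_on_def by metis
  have ED: "E (D v) = v" for v
    by (rule has_derivative_local_inverse[OF D(1) _ open_open_unit_ball[OF M]])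
       (use E gf f0 zero_in_open_unit_ball[OF M] in auto)
  have DE: "D (E v) = v" for v
    by (rule has_derivative_local_inverse[OF E(1) _ open_open_unit_ball[OF N]])
       (use D fg g0 zero_in_open_unit_ball[OF N] in auto)
  have le: "N (D v) \<le> M v" for v
    by (rule derivative_norm_le[OF M N hf im(1) f0 D])
  have ge: "M (E v) \<le> N v" for v
    by (rule derivative_norm_le[OF N M hg im(2) g0 E])
  note [simp] = derivative_complex_linear[OF D] derivative_complex_linear[OF E]
  show ?thesis
  proof
    show "matrix D ** matrix E = Finite_Cartesian_Product.mat 1" "matrix E ** matrix D = Finite_Cartesian_Product.mat 1"
      by (simp_all add: matrix_eq DE ED flip: matrix_vector_mul_assoc)
    show "N (matrix D *v z) = M z" for z
      \<comment> \<open>The reverse inequality is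
        \<open>M z = M (E (D z)) \<le> N (D z)\<close>.\<close>
      using le[of z] ge[of "D z"] by (simp add: ED)
  qed
qed

section \<open>Dual norms and tensor norms under the isometry\<close>

lemma linear_form_vector_matrix: "linear_form (l v* A) z = linear_form l (A *v z)"
proof -
  have "linear_form (l v* A) z = (\<Sum>i\<in>UNIV. \<Sum>j\<in>UNIV. l $ j * A $ j $ i * z $ i)"
    by (simp add: linear_form_def vector_matrix_mult_def sum_distrib_right sum_distrib_left algebra_simps)
  also have "\<dots> = (\<Sum>j\<in>UNIV. \<Sum>i\<in>UNIV. l $ j * A $ j $ i * z $ i)"
    by (rule sum.swap)
  also have "\<dots> = linear_form l (A *v z)"
    by (simp add: linear_form_def matrix_vector_mult_def sum_distrib_left algebra_simps)
  finally show ?thesis .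
qed

lemma vector_matrix_inverse:
  fixes A B :: "'a::comm_semiring_1 ^ 'm::finite ^ 'm"
  assumes "A ** B = Finite_Cartesian_Product.mat 1"
  shows "l v* A v* B = l"
  by (simp add: vector_matrix_mul_assoc assms)

text \<open>\<open>A\<close> maps the closed \<open>M\<close>-ball onto the closed
  \<open>N\<close>-ball, with \<open>B\<close> providing preimages. Hence both suprema are taken
  over the same set of values.\<close>

lemma dual_norm_isometry:
  fixes M N :: "complex ^ 'm::finite \<Rightarrow> real"
  assumes "A ** B = Finite_Cartesian_Product.mat 1" "\<And>z. N (A *v z) = M z"
  shows "dual_norm M (l v* A) = dual_norm N l"
proof -
  have AB: "A *v (B *v z) = z" for z using assms(1) by (simp add: matrix_vector_mul_assoc)
  have "{cmod (linear_form (l v* A) z) | z. M z \<le> 1} = {cmod (linear_form l w) | w. N w \<le> 1}"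
  proof (intro subset_antisym subsetI; clarify)
    fix z assume "M z \<le> 1"
    then show "\<exists>w. cmod (linear_form (l v* A) z) = cmod (linear_form l w) \<and> N w \<le> 1"
      by (intro exI[of _ "A *v z"]) (simp add: assms linear_form_vector_matrix)
  next
    fix w assume "N w \<le> 1"
    moreover have "M (B *v w) = N w" using assms(2)[of "B *v w"] AB by simp
    ultimately show "\<exists>z. cmod (linear_form l w) = cmod (linear_form (l v* A) z) \<and> M z \<le> 1"
      by (intro exI[of _ "B *v w"]) (simp add: AB linear_form_vector_matrix)
  qed
  then show ?thesis unfolding dual_norm_def linear_form_def by simp
qed

text \<open>This is \<open>B \<otimes> id\<close> applied to \<open>\<Theta>\<close>, written in
  components.\<close>

definition tensor_transform ::
  "nat \<Rightarrow> complex ^ 'm ^ 'm::finite \<Rightarrow> ('m \<Rightarrow> complex mat) \<Rightarrow> 'm \<Rightarrow> complex mat" where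
  "tensor_transform k B \<Theta> j = matrix_sum k (\<lambda>i. (B $ j $ i) \<cdot>\<^sub>m \<Theta> i)"

text \<open>Interchanging the two sums moves \<open>B\<close> from the tensor to the functional as
  its transpose.\<close>

lemma matrix_sum_tensor_transform:
  assumes "\<And>i. \<Theta> i \<in> carrier_mat k k"
  shows "matrix_sum k (\<lambda>j. (l $ j) \<cdot>\<^sub>m tensor_transform k B \<Theta> j)
       = matrix_sum k (\<lambda>i. ((l v* B) $ i) \<cdot>\<^sub>m \<Theta> i)"
proof (rule eq_matI)
  fix r s assume "r < dim_row (matrix_sum k (\<lambda>i. ((l v* B) $ i) \<cdot>\<^sub>m \<Theta> i))"
    "s < dim_col (matrix_sum k (\<lambda>i. ((l v* B) $ i) \<cdot>\<^sub>m \<Theta> i))"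
  then have rs: "r < k" "s < k" by (auto simp: matrix_sum_def)
  have [simp]: "dim_row (\<Theta> i) = k" "dim_col (\<Theta> i) = k" for i using assms[of i] by auto
  have "matrix_sum k (\<lambda>j. (l $ j) \<cdot>\<^sub>m tensor_transform k B \<Theta> j) $$ (r, s)
      = (\<Sum>j\<in>UNIV. \<Sum>i\<in>UNIV. l $ j * B $ j $ i * \<Theta> i $$ (r, s))"
    using rs by (simp add: matrix_sum_def tensor_transform_def sum_distrib_left algebra_simps)
  also have "\<dots> = (\<Sum>i\<in>UNIV. \<Sum>j\<in>UNIV. l $ j * B $ j $ i * \<Theta> i $$ (r, s))"
    by (rule sum.swap)
  also have "\<dots> = matrix_sum k (\<lambda>i. ((l v* B) $ i) \<cdot>\<^sub>m \<Theta> i) $$ (r, s)"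
    using rs by (simp add: matrix_sum_def vector_matrix_mult_def sum_distrib_left sum_distrib_right algebra_simps)
  finally show "matrix_sum k (\<lambda>j. (l $ j) \<cdot>\<^sub>m tensor_transform k B \<Theta> j) $$ (r, s)
      = matrix_sum k (\<lambda>i. ((l v* B) $ i) \<cdot>\<^sub>m \<Theta> i) $$ (r, s)" .
qed (simp_all add: matrix_sum_def)

text \<open>The substitution \<open>l v* B\<close> carries the dual ball of \<open>M\<close>
  bijectively onto that of \<open>N\<close>, with inverse \<open>l v* A\<close>, so it merely
  reparametrizes the supremum.\<close>

lemma tensor_norm_transform:
  fixes M N :: "complex ^ 'm::finite \<Rightarrow> real"
  assumes "A ** B = Finite_Cartesian_Product.mat 1" "B ** A = Finite_Cartesian_Product.mat 1" "\<And>z. N (A *v z) = M z"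
    and \<Theta>: "\<And>i. \<Theta> i \<in> carrier_mat k k"
  shows "tensor_norm M k (tensor_transform k B \<Theta>) = tensor_norm N k \<Theta>"
proof -
  let ?F = "\<lambda>l. op_norm (matrix_sum k (\<lambda>i. (l $ i) \<cdot>\<^sub>m \<Theta> i))"
  have BA: "l v* B v* A = l" for l using assms(2) by (rule vector_matrix_inverse)
  have AB: "l v* A v* B = l" for l using assms(1) by (rule vector_matrix_inverse)
  have dual: "dual_norm M (l v* A) = dual_norm N l" for l
    by (rule dual_norm_isometry[of A B]) (use assms in auto)
  have "{?F (l v* B) | l. dual_norm M l \<le> 1} = {?F l | l. dual_norm N l \<le> 1}"
  proof (intro subset_antisym subsetI; clarify)
    fix l assume "dual_norm M l \<le> 1"
    then show "\<exists>l'. ?F (l v* B) = ?F l' \<and> dual_norm N l' \<le> 1"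
      using dual[of "l v* B"] by (intro exI[of _ "l v* B"]) (simp add: BA)
  next
    fix l assume "dual_norm N l \<le> 1"
    then show "\<exists>l'. ?F l = ?F (l' v* B) \<and> dual_norm M l' \<le> 1"
      by (intro exI[of _ "l v* A"]) (simp add: AB dual)
  qed
  then show ?thesis
    unfolding tensor_norm_def matrix_sum_tensor_transform[OF \<Theta>] by simp
qed

section \<open>Complete contractivity under the isometry\<close>

lemma matrix_linear_entry:
  fixes L :: "complex ^ 'm::finite \<Rightarrow> complex mat"
  assumes "matrix_linear n L" "r < n" "s < n"
  shows "L z $$ (r, s) = (\<Sum>j\<in>UNIV. z $ j * L (axis j 1) $$ (r, s))"
proof -
  have [simp]: "dim_row (L z) = n" "dim_col (L z) = n" for z
    using assms(1) carrier_matD unfolding matrix_linear_def by blast+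
  \<comment> \<open>At a fixed position the entry is a scalar linear functional of the argument, so
    its basis expansion is an ordinary finite sum.\<close>
  have add: "L (x + y) $$ (r, s) = L x $$ (r, s) + L y $$ (r, s)" for x y
    using assms unfolding matrix_linear_def by simp
  have smult: "L (c *s x) $$ (r, s) = c * L x $$ (r, s)" for c x
    using assms unfolding matrix_linear_def by simp
  have sum: "L (\<Sum>j\<in>J. z $ j *s axis j 1) $$ (r, s) = (\<Sum>j\<in>J. z $ j * L (axis j 1) $$ (r, s))"
    if "finite J" for J
    using that
  proof induction
    case empty
    show ?case using smult[of 0 0] by simp
  qed (simp add: add smult)
  show ?thesis using sum[of UNIV] by (simp add: basis_expansion)
qed

text \<open>By bilinearity of the Kronecker product, \<open>B\<close> moves across it from the
  tensor factor to the argument of \<open>L\<close>.\<close>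

lemma matrix_sum_kronecker_transform:
  fixes L :: "complex ^ 'm::finite \<Rightarrow> complex mat"
  assumes L: "matrix_linear n L" and \<Theta>: "\<And>i. \<Theta> i \<in> carrier_mat k k"
  shows "matrix_sum (k * n) (\<lambda>j. kronecker (tensor_transform k B \<Theta> j) (L (axis j 1)))
       = matrix_sum (k * n) (\<lambda>i. kronecker (\<Theta> i) (L (B *v axis i 1)))"
    (is "?l = ?r")
proof (rule eq_matI)
  fix r s assume "r < dim_row ?r" "s < dim_col ?r"
  then have rs: "r < k * n" "s < k * n" by (auto simp: matrix_sum_def)
  \<comment> \<open>For \<open>n = 0\<close> there are no indices below \<open>k * n\<close>;
    positivity is what bounds the remainders modulo \<open>n\<close>.\<close>
  then have n: "0 < n" by (cases n) auto
  have rs': "r div n < k" "s div n < k" "r mod n < n" "s mod n < n"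
    using rs n by (auto simp: less_mult_imp_div_less)
  have [simp]: "dim_row (\<Theta> i) = k" "dim_col (\<Theta> i) = k" for i using \<Theta>[of i] by auto
  have [simp]: "dim_row (L z) = n" "dim_col (L z) = n" for z
    using L carrier_matD unfolding matrix_linear_def by blast+
  have [simp]: "dim_row (tensor_transform k B \<Theta> j) = k" "dim_col (tensor_transform k B \<Theta> j) = k" for j
    by (simp_all add: tensor_transform_def matrix_sum_def)
  have col: "(B *v axis i 1) $ j = B $ j $ i" for i j
    by (simp add: matrix_vector_mult_def axis_def if_distrib cong: if_cong)
  let ?t = "\<lambda>i j. B $ j $ i * \<Theta> i $$ (r div n, s div n) * L (axis j 1) $$ (r mod n, s mod n)"
  have "?l $$ (r, s) = (\<Sum>j\<in>UNIV. \<Sum>i\<in>UNIV. ?t i j)"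
    using rs rs' by (simp add: matrix_sum_def kronecker_def tensor_transform_def sum_distrib_right)
  also have "\<dots> = (\<Sum>i\<in>UNIV. \<Sum>j\<in>UNIV. ?t i j)"
    by (rule sum.swap)
  also have "\<dots> = ?r $$ (r, s)"
    using rs rs'
    by (simp add: matrix_sum_def kronecker_def col sum_distrib_left mult_ac
        matrix_linear_entry[OF L rs'(3,4), of "B *v axis _ 1"])
  finally show "?l $$ (r, s) = ?r $$ (r, s)" .
qed (simp_all add: matrix_sum_def)

lemma completely_contractive_isometry:
  fixes M N :: "complex ^ 'm::finite \<Rightarrow> real"
  assumes AB: "A ** B = Finite_Cartesian_Product.mat 1" "B ** A = Finite_Cartesian_Product.mat 1" and iso: "\<And>z. N (A *v z) = M z"
    and M: "\<And>L. matrix_linear n L \<Longrightarrow> contractive M L \<Longrightarrow> completely_contractive M n L"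
    and L: "matrix_linear n L" "contractive N L"
  shows "completely_contractive N n L"
proof -
  \<comment> \<open>The pullback of \<open>L\<close> along the isometry is contractive for
    \<open>M\<close>, so the hypothesis on \<open>M\<close> applies to it.\<close>
  define L' where "L' z = L (A *v z)" for z
  have lin: "matrix_linear n L'"
    using L(1) unfolding matrix_linear_def L'_def
    by (simp add: matrix_vector_right_distrib vec.scale)
  have "contractive M L'"
    using L(2) iso unfolding contractive_def L'_def by metis
  then have cc: "completely_contractive M n L'" using M lin by blast
  have L'B: "L' (B *v z) = L z" for z
    using AB(1) by (simp add: L'_def matrix_vector_mul_assoc)
  show ?thesis
    unfolding completely_contractive_def
  proof (intro allI impI)
    fix k :: nat and \<Theta> :: "'m \<Rightarrow> complex mat"
    assume k: "1 \<le> k" and "\<forall>i. \<Theta> i \<in> carrier_mat k k"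
    then have \<Theta>: "\<And>i. \<Theta> i \<in> carrier_mat k k" by blast
    \<comment> \<open>Testing \<open>L'\<close> on the transformed tensor makes \<open>A\<close> and
      \<open>B\<close> cancel on the left and gives the \<open>N\<close>-norm of
      \<open>\<Theta>\<close> on the right.\<close>
    have "\<forall>j. tensor_transform k B \<Theta> j \<in> carrier_mat k k"
      by (simp add: tensor_transform_def matrix_sum_def)
    then have "op_norm (matrix_sum (k * n) (\<lambda>j. kronecker (tensor_transform k B \<Theta> j) (L' (axis j 1))))
        \<le> tensor_norm M k (tensor_transform k B \<Theta>)"
      using cc k unfolding completely_contractive_def by blast
    then show "op_norm (matrix_sum (k * n) (\<lambda>i. kronecker (\<Theta> i) (L (axis i 1)))) \<le> tensor_norm N k \<Theta>"
      by (simp add: matrix_sum_kronecker_transform[OF lin \<Theta>] L'B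
          tensor_norm_transform[of A B N M \<Theta> k, OF AB iso \<Theta>])
  qed
qed

theorem corollary2p19:
  fixes N_Omega N_Omega' :: "complex ^ 'm::finite \<Rightarrow> real"
    and \<phi> :: "complex ^ 'm \<Rightarrow> complex ^ 'm"
  assumes "is_norm N_Omega" and "is_norm N_Omega'"
    and "biholomorphic \<phi> (open_unit_ball N_Omega') (open_unit_ball N_Omega)"
    and "\<phi> 0 = 0"
  shows "(\<forall>n\<ge>1. \<forall>L. matrix_linear n L \<and> contractive N_Omega L \<longrightarrow>
             completely_contractive N_Omega n L) \<longleftrightarrow>
         (\<forall>n\<ge>1. \<forall>L. matrix_linear n L \<and> contractive N_Omega' L \<longrightarrow>
             completely_contractive N_Omega' n L)"
proof -
  obtain A B :: "complex ^ 'm ^ 'm" where AB: "A ** B = Finite_Cartesian_Product.mat 1" "B ** A = Finite_Cartesian_Product.mat 1"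
    and A: "\<And>z. N_Omega (A *v z) = N_Omega' z"
    using biholomorphic_imp_linear_isometry[OF assms(2,1,3,4)] by blast
  \<comment> \<open>The inverse is isometric too, so exchanging \<open>A\<close> and
    \<open>B\<close> yields the other implication.\<close>
  have B: "N_Omega' (B *v z) = N_Omega z" for z
    using A[of "B *v z"] AB(1) by (simp add: matrix_vector_mul_assoc)
  show ?thesis
    using completely_contractive_isometry[of A B N_Omega N_Omega', OF AB A]
      completely_contractive_isometry[of B A N_Omega' N_Omega, OF AB(2,1) B] by blast
qed

end
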